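(* Let $n \geq 1$ be an integer and let $e_1, \ldots, e_n$ be integers. There exists a divisor of splitting type $(e_1, \ldots, e_n)$ on the complete graph $K_n$ if and only if, when the integers are arranged (and relabeled) in decreasing order $e_1 \geq e_2 \geq \cdots \geq e_n$, we have $e_i \leq e_{i+1} + 1$ for all $i$ with $1 \leq i \leq n-1$.
   Context: $K_n$ is the complete graph with $n$ vertices $v_1, \ldots, v_n$, in which every pair of distinct vertices is joined by exactly one edge. A divisor on $K_n$ is a formal $\mathbb{Z}$-linear combination $D = \sum_{i=1}^n a_i v_i$ of the vertices (with $a_i \in \mathbb{Z}$, possibly negative); its degree is $\deg(D) = \sum_{i=1}^n a_i$, and it is effective if $a_i \geq 0$ for all $i$. Firing a vertex $v_j$ replaces $D$ by the divisor obtained by decreasing the coefficient of $v_j$ by $n-1$ and increasing the coefficient of every other vertex by $1$. Two divisors are equivalent if one can be obtained from the other by a finite sequence of such chip-firing moves. Rank: if $D$ is not equivalent to an effective divisor, then $\mathrm{rk}(D) = -1$. Otherwise $\mathrm{rk}(D)$ is the maximum integer $r$ such that, for all effective divisors $E$ of degree $r$, the divisor $D - E$ is equivalent to an effective divisor. Let $L = v_1 + v_2 + \cdots + v_n$. For integers $e_1, \ldots, e_n$, a divisor $D$ on $K_n$ has splitting type $(e_1, \ldots, e_n)$ if $$\mathrm{rk}(D + kL) = \Big( \sum_{i=1}^n \max\{0, e_i + k + 1\} \Big) - 1 \quad \text{for all } k \in \mathbb{Z}.$$ This condition does not depend on the order of the integers $e_1, \ldots, e_n$. Here "decreasing" means weakly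 decreasing. *)

theory Defs
  imports Main
begin

text \<open>The vertices of the complete graph on \<open>n\<close> vertices are \<open>0, \<dots>, n - 1\<close>. A divisor is an
  integer-valued function vanishing outside the vertex set, so that equality of divisors is
  equality of functions.\<close>

definition divisors :: "nat \<Rightarrow> (nat \<Rightarrow> int) set" where
  "divisors n = {D. \<forall>i. i \<ge> n \<longrightarrow> D i = 0}"

definition deg :: "nat \<Rightarrow> (nat \<Rightarrow> int) \<Rightarrow> int" where
  "deg n D = (\<Sum>i<n. D i)"

definition effective :: "nat \<Rightarrow> (nat \<Rightarrow> int) \<Rightarrow> bool" where
  "effective n D \<longleftrightarrow> (\<forall>i<n. D i \<ge> 0)"

definition fire :: "nat \<Rightarrow> nat \<Rightarrow> (nat \<Rightarrow> int) \<Rightarrow> (nat \<Rightarrow> int)" where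
  "fire n j D = (\<lambda>i. if i = j then D i - (int n - 1) else if i < n then D i + 1 else D i)"

definition fires_to :: "nat \<Rightarrow> (nat \<Rightarrow> int) \<Rightarrow> (nat \<Rightarrow> int) \<Rightarrow> bool" where
  "fires_to n D D' \<longleftrightarrow> (\<exists>j<n. D' = fire n j D)"

text \<open>Reachability by finitely many moves is already symmetric: firing every vertex once is the
  identity, so a move at one vertex is undone by firing all the others.\<close>

definition equivalent :: "nat \<Rightarrow> (nat \<Rightarrow> int) \<Rightarrow> (nat \<Rightarrow> int) \<Rightarrow> bool" where
  "equivalent n = (fires_to n)\<^sup>*\<^sup>*"

definition equiv_effective :: "nat \<Rightarrow> (nat \<Rightarrow> int) \<Rightarrow> bool" where
  "equiv_effective n D \<longleftrightarrow> (\<exists>D'\<in>divisors n. effective n D' \<and> equivalent n D D')"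

text \<open>For \<open>n \<ge> 1\<close> the maximum below exists: negative \<open>r\<close> qualify vacuously, \<open>r = 0\<close> qualifies in
  the second branch, and no \<open>r > deg n D\<close> does, since moves preserve the degree.\<close>

definition rk :: "nat \<Rightarrow> (nat \<Rightarrow> int) \<Rightarrow> int" where
  "rk n D = (if \<not> equiv_effective n D then -1
     else (GREATEST r. \<forall>E\<in>divisors n. effective n E \<and> deg n E = r \<longrightarrow>
             equiv_effective n (\<lambda>i. D i - E i)))"

definition L :: "nat \<Rightarrow> nat \<Rightarrow> int" where
  "L n = (\<lambda>i. if i < n then 1 else 0)"

definition has_splitting_type :: "nat \<Rightarrow> (nat \<Rightarrow> int) \<Rightarrow> int list \<Rightarrow> bool" where
  "has_splitting_type n D es \<longleftrightarrow>
     (\<forall>k::int. rk n (\<lambda>i. D i + k * L n i) = (\<Sum>i<n. max 0 (es ! i + k + 1)) - 1)"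

end

theory Submission
  imports Defs "HOL-Library.Multiset"
begin

text \<open>Two divisors of \<open>K\<^sub>n\<close> are equivalent exactly when they have the same degree and their
  residues modulo \<open>n\<close> differ by a common constant.  It is therefore natural to view the entry
  \<open>D i\<close> as the \<open>n\<close>-periodic family \<open>D i + k n\<close> of integers, and to sort all these families at
  once: an affine permutation \<open>p\<close> gives \<open>D i + k n\<close> the position \<open>p i + k n\<close>, in such a way that
  the entries increase weakly along the positions.  The window
  sum of \<open>p\<close> is fixed, whatever the degree of \<open>D\<close>.

  The key fact is \<open>rk D + 1 = (\<Sum>i<n. max 0 (D i - p i + 1))\<close> for a sorting \<open>p\<close> of \<open>D\<close>
  (\<open>rank_eq_excess\<close>); call the right-hand side the excess.  For the upper bound, subtract just
  enough chips to get below the divisor \<open>p - 1\<close>, which has distinct residues but too small a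
  degree for an effective equivalent (\<open>not_equiv_effective_below_affine_perm\<close>).  For the lower
  bound, removing one chip lowers the excess by at most one (\<open>sorts_remove_chip\<close>), and as
  long as the excess is positive some entry satisfies \<open>D v \<ge> p v\<close>; reading the \<open>n\<close> consecutive
  entries from that position onwards gives an effective equivalent
  (\<open>equiv_effective_if_sorted\<close>).

  Adding \<open>k L\<close> raises every entry by \<open>k\<close> and leaves \<open>p\<close> a sorting, so every divisor has a
  splitting type, namely the numbers \<open>D i - p i\<close>, and the ranks determine this multiset.
  Along consecutive positions \<open>D\<close> does not decrease while the position grows by one, so these
  numbers drop by at most one at each step.  As they recur with period \<open>n\<close>, they cannot get from
  a large value to a small one without taking every value in between, which is the gap condition
  (\<open>sorts_values_convex\<close>).  Conversely, if \<open>e\<^sub>0 \<ge> e\<^sub>1 \<ge> \<dots>\<close> has gaps at most one, then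
  \<open>D i = e\<^sub>i + i\<close> is sorted by the identity and has splitting type \<open>e\<close>.\<close>

section \<open>Chip-firing equivalence\<close>

lemma equivalent_by_firing_script:
  fixes f :: "nat \<Rightarrow> nat"
  shows "equivalent n D
    (\<lambda>i. if i < n then D i + int (\<Sum>j<n. f j) - int n * int (f i) else D i)"
proof (induction "\<Sum>j<n. f j" arbitrary: f)
  case 0
  then have "(\<lambda>i. if i < n then D i + int (\<Sum>j<n. f j) - int n * int (f i) else D i) = D"
    by (auto simp: fun_eq_iff)
  then show ?case
    by (simp add: equivalent_def)
next
  case (Suc s)
  then obtain j where j: "j < n" "f j > 0"
    by (metis gr0I lessThan_iff nat.simps(3) sum.neutral)
  define g where "g = f(j := f j - 1)"
  have "(\<Sum>i<n. f i) = f j + (\<Sum>i\<in>{..<n} - {j}. f i)"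
    using j by (simp add: sum.remove)
  moreover have "(\<Sum>i<n. g i) = g j + (\<Sum>i\<in>{..<n} - {j}. g i)"
    using j by (simp add: sum.remove)
  moreover have "(\<Sum>i\<in>{..<n} - {j}. g i) = (\<Sum>i\<in>{..<n} - {j}. f i)"
    by (rule sum.cong) (auto simp: g_def)
  ultimately have sg: "s = (\<Sum>i<n. g i)" and sf: "(\<Sum>i<n. f i) = Suc (\<Sum>i<n. g i)"
    using Suc.hyps(2) j by (auto simp: g_def)
  let ?G = "\<lambda>i. if i < n then D i + int (\<Sum>j<n. g j) - int n * int (g i) else D i"
  have "(\<lambda>i. if i < n then D i + int (\<Sum>j<n. f j) - int n * int (f i) else D i) = fire n j ?G"
    unfolding sf fire_def using j by (auto simp: fun_eq_iff g_def algebra_simps of_nat_diff)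
  then have "fires_to n ?G
      (\<lambda>i. if i < n then D i + int (\<Sum>j<n. f j) - int n * int (f i) else D i)"
    unfolding fires_to_def using j by blast
  then show ?case
    using Suc.hyps(1)[OF sg] unfolding equivalent_def by (rule rtranclp.rtrancl_into_rtrancl[rotated])
qed

text \<open>Firing every vertex once changes nothing, so a script with negative entries can be shifted
  by a constant until it is a script of actual moves.\<close>

lemma equivalentI:
  fixes f :: "nat \<Rightarrow> int"
  assumes "D \<in> divisors n" "D' \<in> divisors n"
    and f: "\<And>i. i < n \<Longrightarrow> D' i = D i + (\<Sum>j<n. f j) - int n * f i"
  shows "equivalent n D D'"
proof -
  define c where "c = (\<Sum>j<n. \<bar>f j\<bar>)"
  define g where "g i = nat (f i + c)" for i
  have g: "int (g i) = f i + c" if "i < n" for i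
  proof -
    have "\<bar>f i\<bar> \<le> c"
      unfolding c_def using that by (intro member_le_sum) auto
    then show ?thesis
      by (simp add: g_def)
  qed
  have "int (\<Sum>j<n. g j) = (\<Sum>j<n. f j) + int n * c"
    using g by (simp add: sum.distrib)
  then have "D' = (\<lambda>i. if i < n then D i + int (\<Sum>j<n. g j) - int n * int (g i) else D i)"
    using assms g by (auto simp: fun_eq_iff divisors_def algebra_simps)
  then show ?thesis
    using equivalent_by_firing_script[of n D g] by simp
qed

lemma equivalentE:
  assumes "equivalent n D D'"
  obtains f :: "nat \<Rightarrow> int"
  where "\<And>i. i < n \<Longrightarrow> D' i = D i + (\<Sum>j<n. f j) - int n * f i"
proof -
  have "\<exists>f :: nat \<Rightarrow> int. \<forall>i<n. D' i = D i + (\<Sum>j<n. f j) - int n * f i"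
    using assms unfolding equivalent_def
  proof (induction rule: rtranclp_induct)
    case base
    show ?case
      by (rule exI[of _ "\<lambda>_. 0"]) simp
  next
    case (step F G)
    then obtain f :: "nat \<Rightarrow> int" and j where
      f: "\<And>i. i < n \<Longrightarrow> F i = D i + (\<Sum>j<n. f j) - int n * f i" and
      j: "j < n" "G = fire n j F"
      unfolding fires_to_def by blast
    have "(\<Sum>i<n. (f(j := f j + 1)) i) = (\<Sum>i<n. f i + (if i = j then 1 else 0))"
      by (rule sum.cong) auto
    then have "(\<Sum>i<n. (f(j := f j + 1)) i) = (\<Sum>i<n. f i) + 1"
      using j by (simp add: sum.distrib sum.delta)
    then show ?case
      using f j by (intro exI[of _ "f(j := f j + 1)"]) (auto simp: fire_def algebra_simps)
  qed
  then show thesis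
    using that by blast
qed

section \<open>Affine permutations\<close>

text \<open>The window of an affine permutation: the \<open>p i + k * n\<close> for \<open>i < n\<close> and integral \<open>k\<close>
  run through every integer once.  The sum is normalised as for the identity.\<close>

definition affine_perm :: "nat \<Rightarrow> (nat \<Rightarrow> int) \<Rightarrow> bool" where
  "affine_perm n p \<longleftrightarrow>
    inj_on (\<lambda>i. p i mod int n) {..<n} \<and> (\<Sum>i<n. p i) = (\<Sum>i<n. int i)"

lemma distinct_residues_image:
  fixes p :: "nat \<Rightarrow> int"
  assumes "inj_on (\<lambda>i. p i mod int n) {..<n}"
  shows "(\<lambda>i. p i mod int n) ` {..<n} = int ` {..<n}"
proof (rule card_subset_eq)
  show "(\<lambda>i. p i mod int n) ` {..<n} \<subseteq> int ` {..<n}"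
  proof
    fix x assume "x \<in> (\<lambda>i. p i mod int n) ` {..<n}"
    then have "0 \<le> x" "x < int n"
      by auto
    then show "x \<in> int ` {..<n}"
      by (intro image_eqI[of _ _ "nat x"]) auto
  qed
  show "card ((\<lambda>i. p i mod int n) ` {..<n}) = card (int ` {..<n})"
    using card_image[OF assms] by (simp add: card_image)
qed simp

lemma sum_distinct_residues:
  fixes p :: "nat \<Rightarrow> int"
  assumes "inj_on (\<lambda>i. p i mod int n) {..<n}"
  shows "(\<Sum>i<n. p i mod int n) = (\<Sum>i<n. int i)"
proof -
  have "(\<Sum>i<n. p i mod int n) = \<Sum>((\<lambda>i. p i mod int n) ` {..<n})"
    using assms by (simp add: sum.reindex)
  also have "\<dots> = (\<Sum>i<n. int i)"
    by (simp add: distinct_residues_image[OF assms] sum.reindex)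
  finally show ?thesis .
qed

lemma inj_on_residues_shift:
  fixes p :: "nat \<Rightarrow> int"
  assumes "inj_on (\<lambda>i. p i mod int n) A"
    and "\<And>i. i \<in> A \<Longrightarrow> q i mod int n = (p i + c) mod int n"
  shows "inj_on (\<lambda>i. q i mod int n) A"
proof (rule inj_onI)
  fix i j assume ij: "i \<in> A" "j \<in> A" "q i mod int n = q j mod int n"
  then have "int n dvd p i - p j"
    using assms(2) by (simp add: mod_eq_dvd_iff)
  then show "i = j"
    using assms(1) ij by (auto simp: inj_on_def mod_eq_dvd_iff)
qed

lemma affine_perm_position:
  assumes "affine_perm n p" "n \<ge> 1"
  obtains i k where "i < n" "q = p i + k * int n"
proof -
  have "q mod int n \<in> int ` {..<n}"
    using assms by (intro image_eqI[of _ _ "nat (q mod int n)"]) (auto simp: nat_less_iff)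
  then obtain i where i: "i < n" "q mod int n = p i mod int n"
    using assms distinct_residues_image[of p n] by (auto simp: affine_perm_def)
  then have "int n dvd q - p i"
    by (simp add: mod_eq_dvd_iff)
  then obtain k where "q - p i = int n * k" ..
  then show thesis
    using i that[of i k] by (simp add: algebra_simps)
qed

text \<open>The largest divisors without effective equivalent: the residues of an equivalent divisor are
  again distinct, and distinct residues add up to at least \<open>0 + \<dots> + (n - 1)\<close>.\<close>

lemma not_equiv_effective_below_affine_perm:
  assumes p: "affine_perm n p" and n: "n \<ge> 1" and le: "\<And>i. i < n \<Longrightarrow> D i \<le> p i - 1"
  shows "\<not> equiv_effective n D"
proof
  assume "equiv_effective n D"
  then obtain D' where D': "effective n D'" "equivalent n D D'"
    by (auto simp: equiv_effective_def)
  then obtain f :: "nat \<Rightarrow> int" where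
    f: "\<And>i. i < n \<Longrightarrow> D' i = D i + (\<Sum>j<n. f j) - int n * f i"
    using equivalentE by blast
  define s where "s = (\<Sum>j<n. f j)"
  define G where "G i = p i - 1 + s - int n * f i" for i
  have G0: "G i \<ge> 0" if "i < n" for i
    using that D'(1) le[OF that] f[OF that] by (auto simp: G_def s_def effective_def)
  have "inj_on (\<lambda>i. G i mod int n) {..<n}"
  proof (rule inj_on_residues_shift[where c = "s - 1"])
    show "inj_on (\<lambda>i. p i mod int n) {..<n}"
      using p by (simp add: affine_perm_def)
    show "G i mod int n = (p i + (s - 1)) mod int n" for i
      by (simp add: G_def mod_eq_dvd_iff)
  qed
  then have "(\<Sum>i<n. int i) = (\<Sum>i<n. G i mod int n)"
    by (simp add: sum_distinct_residues)
  also have "\<dots> \<le> (\<Sum>i<n. G i)"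
    using G0 n by (intro sum_mono) (simp add: zmod_le_nonneg_dividend)
  also have "\<dots> = (\<Sum>i<n. p i) - int n"
    by (simp add: G_def sum.distrib sum_subtractf sum_distrib_left[symmetric] s_def)
  finally show False
    using p n by (simp add: affine_perm_def)
qed

section \<open>Sorting a divisor\<close>

text \<open>The condition says that \<open>D i + k * n\<close> is a weakly increasing function of the position
  \<open>p i + k * n\<close>; by periodicity one of the two shifts may be taken to be \<open>0\<close>.  Entries that
  tie may be placed in any order.\<close>

definition sorts :: "nat \<Rightarrow> (nat \<Rightarrow> int) \<Rightarrow> (nat \<Rightarrow> int) \<Rightarrow> bool" where
  "sorts n p D \<longleftrightarrow> affine_perm n p \<and>
    (\<forall>i<n. \<forall>j<n. \<forall>k. p i < p j + k * int n \<longrightarrow> D i \<le> D j + k * int n)"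

definition excess :: "nat \<Rightarrow> (nat \<Rightarrow> int) \<Rightarrow> (nat \<Rightarrow> int) \<Rightarrow> int" where
  "excess n p D = (\<Sum>i<n. max 0 (D i - p i + 1))"

lemma sortsD:
  assumes "sorts n p D" "i < n" "j < n" "p i < p j + k * int n"
  shows "D i \<le> D j + k * int n"
  using assms by (auto simp: sorts_def)

lemma excess_nonneg: "excess n p D \<ge> 0"
  by (auto simp: excess_def intro: sum_nonneg)

lemma excess_pos_iff: "excess n p D \<ge> 1 \<longleftrightarrow> (\<exists>i<n. D i \<ge> p i)"
proof -
  have "max 0 (D i - p i + 1) = 0 \<longleftrightarrow> D i < p i" for i
    by auto
  then have "excess n p D = 0 \<longleftrightarrow> (\<forall>i<n. D i < p i)"
    unfolding excess_def by (subst sum_nonneg_eq_0_iff) auto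
  then show ?thesis
    using excess_nonneg[of n p D] by (auto simp: not_less int_one_le_iff_zero_less order_less_le)
qed

lemma sorts_add_multiple_L:
  assumes "sorts n p D"
  shows "sorts n p (\<lambda>i. D i + k * L n i)"
  using assms by (auto simp: sorts_def L_def algebra_simps)

text \<open>Shift every position by a multiple of \<open>n\<close> into the window that starts at \<open>p v\<close>.  There
  \<open>D v\<close> is the smallest entry, so subtracting \<open>p v\<close> from all entries leaves an effective
  divisor.  The normalisation of the sum of \<open>p\<close> is what makes this an equivalence: the shifts
  add up to exactly the number of chips subtracted from each vertex.\<close>

lemma equiv_effective_if_sorted:
  assumes D: "D \<in> divisors n" and p: "sorts n p D" and v: "v < n" "D v \<ge> p v"
  shows "equiv_effective n D"
proof -
  have inj: "inj_on (\<lambda>i. p i mod int n) {..<n}" and sum: "(\<Sum>i<n. p i) = (\<Sum>i<n. int i)"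
    using p by (auto simp: sorts_def affine_perm_def)
  define f where "f i = (p i - p v) div int n" for i
  define D' where "D' i = (if i < n then D i + (\<Sum>j<n. f j) - int n * f i else D i)" for i
  have split: "p i - int n * f i = p v + (p i - p v) mod int n" for i
    using mult_div_mod_eq[of "int n" "p i - p v"] unfolding f_def by linarith
  have "inj_on (\<lambda>i. (p i - p v) mod int n) {..<n}"
    by (rule inj_on_residues_shift[OF inj, where c = "- p v"]) simp
  then have "(\<Sum>i<n. p i - int n * f i) = int n * p v + (\<Sum>i<n. int i)"
    unfolding split by (simp add: sum.distrib sum_distinct_residues)
  then have "int n * (\<Sum>i<n. f i) = int n * (- p v)"
    using sum by (simp add: sum_subtractf sum_distrib_left)
  then have sumf: "(\<Sum>i<n. f i) = - p v"
    using v by (metis less_nat_zero_code mult_cancel_left of_nat_eq_0_iff)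
  have D'div: "D' \<in> divisors n"
    using D by (simp add: D'_def divisors_def)
  moreover have "equivalent n D D'"
    by (rule equivalentI[OF D D'div, of f]) (simp add: D'_def)
  moreover have "D' i \<ge> 0" if "i < n" for i
  proof (cases "i = v")
    case True
    then show ?thesis
      using v sumf by (simp add: D'_def) (simp add: f_def)
  next
    case False
    then have "(p i - p v) mod int n \<noteq> 0"
      using inj v that by (auto simp: inj_on_def mod_eq_dvd_iff mod_eq_0_iff_dvd)
    moreover have "(p i - p v) mod int n \<ge> 0"
      using v by simp
    ultimately have "p v < p i + (- f i) * int n"
      using split[of i] by (simp add: algebra_simps)
    then have "D v \<le> D i + (- f i) * int n"
      by (rule sortsD[OF p v(1) that])
    then show ?thesis
      using v that by (simp add: D'_def sumf algebra_simps)
  qed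
  ultimately show ?thesis
    by (auto simp: equiv_effective_def effective_def)
qed

text \<open>Removing a chip from the entry \<open>D v\<close> keeps the order as long as \<open>v\<close> comes first
  among the entries tied with it.  Ties may be reordered freely: exchanging the positions of \<open>v\<close>
  and of the first tied vertex \<open>u\<close> only exchanges the numbers \<open>D i - p i\<close> at \<open>u\<close> and \<open>v\<close>, and
  so leaves the excess alone.\<close>

lemma sorts_remove_chip:
  assumes p: "sorts n p D" and v: "v < n"
  obtains p' where "sorts n p' (D(v := D v - 1))"
    "excess n p D \<le> excess n p' (D(v := D v - 1)) + 1"
proof -
  \<comment> \<open>The vertices with a lift tied with \<open>D v\<close>.  The tied lift of \<open>j\<close> has position
    \<open>D v - (D j - p j)\<close>, so the first one belongs to the largest \<open>D j - p j\<close>.\<close>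
  define T where "T = {j. j < n \<and> int n dvd D v - D j}"
  have "finite T" "v \<in> T"
    using v by (auto simp: T_def)
  then obtain u where u: "u \<in> T" and max: "\<And>j. j \<in> T \<Longrightarrow> D j - p j \<le> D u - p u"
    using finite_imageI[of T "\<lambda>j. D j - p j"] Max_in[of "(\<lambda>j. D j - p j) ` T"]
      Max_ge[of "(\<lambda>j. D j - p j) ` T"]
    by (metis (no_types, lifting) empty_iff image_eqI imageE)
  define t where "t = id(v := u, u := v)"
  define p' where "p' i = p (t i) + (D i - D (t i))" for i
  have t: "bij_betw t {..<n} {..<n}"
    by (rule bij_betw_byWitness[where f' = t]) (use u v in \<open>auto simp: t_def T_def\<close>)
  have tn: "t i < n" if "i < n" for i
    using t that by (auto simp: bij_betw_def)
  have tdvd: "int n dvd D i - D (t i)" for i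
    using u by (auto simp: t_def T_def dvd_diff_commute)
  have reindex: "(\<Sum>i<n. g (t i)) = (\<Sum>i<n. g i)" for g :: "nat \<Rightarrow> int"
    by (rule sum.reindex_bij_betw[OF t])
  have "inj_on (\<lambda>i. p' i mod int n) {..<n}"
  proof (rule inj_on_residues_shift[where c = 0])
    show "inj_on (\<lambda>i. p (t i) mod int n) {..<n}"
      using comp_inj_on[OF bij_betw_imp_inj_on[OF t], of "\<lambda>i. p i mod int n"] p t
      by (auto simp: sorts_def affine_perm_def bij_betw_def comp_def)
    show "p' i mod int n = (p (t i) + 0) mod int n" for i
      using tdvd by (simp add: p'_def mod_eq_dvd_iff)
  qed
  moreover have "(\<Sum>i<n. p' i) = (\<Sum>i<n. int i)"
    using p by (simp add: p'_def sum.distrib sum_subtractf reindex sorts_def affine_perm_def)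
  ultimately have aff: "affine_perm n p'"
    by (simp add: affine_perm_def)
  \<comment> \<open>\<open>p'\<close> places \<open>i\<close> where \<open>p\<close> places a lift of \<open>t i\<close> with the same entry, so it sorts \<open>D\<close> too.\<close>
  have sorted: "D i \<le> D j + k * int n" if ij: "i < n" "j < n" "p' i < p' j + k * int n" for i j k
  proof -
    obtain a b where a: "D i - D (t i) = int n * a" and b: "D j - D (t j) = int n * b"
      using tdvd by (meson dvdE)
    have "p (t i) < p (t j) + (b - a + k) * int n"
      using ij a b by (simp add: p'_def algebra_simps)
    then have "D (t i) \<le> D (t j) + (b - a + k) * int n"
      by (rule sortsD[OF p tn[OF ij(1)] tn[OF ij(2)]])
    then show ?thesis
      using a b by (simp add: algebra_simps)
  qed
  have "(D(v := D v - 1)) i \<le> (D(v := D v - 1)) j + k * int n"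
    if ij: "i < n" "j < n" "p' i < p' j + k * int n" for i j k
  proof (cases "j = v \<and> i \<noteq> v")
    case True
    \<comment> \<open>Only an entry tied with the reduced one could now be out of order, and none precedes it.\<close>
    have "D i \<noteq> D v + k * int n"
    proof
      assume eq: "D i = D v + k * int n"
      then have "i \<in> T"
        using ij by (simp add: T_def)
      then have "t i \<in> T"
        using u \<open>v \<in> T\<close> by (auto simp: t_def)
      then have "D i - p' i \<le> D v - p' v"
        using max by (auto simp: p'_def t_def split: if_splits)
      then show False
        using eq ij True by simp
    qed
    then show ?thesis
      using sorted[OF ij] True by simp
  next
    case False
    then show ?thesis
      using sorted[OF ij] by auto
  qed
  then have "sorts n p' (D(v := D v - 1))"
    using aff by (simp add: sorts_def)
  moreover have "excess n p D \<le> excess n p' (D(v := D v - 1)) + 1"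
  proof -
    have "excess n p D = (\<Sum>i<n. max 0 (D i - p' i + 1))"
      unfolding excess_def reindex[symmetric, of "\<lambda>i. max 0 (D i - p i + 1)"]
      by (simp add: p'_def)
    also have "\<dots> \<le> (\<Sum>i<n. max 0 ((D(v := D v - 1)) i - p' i + 1) + (if i = v then 1 else 0))"
      by (intro sum_mono) auto
    also have "\<dots> = excess n p' (D(v := D v - 1)) + 1"
      using v by (simp add: excess_def sum.distrib sum.delta)
    finally show ?thesis .
  qed
  ultimately show thesis
    by (rule that)
qed

lemma sorts_subtract_effective:
  assumes "sorts n p D" "E \<in> divisors n" "effective n E"
  obtains p' where "sorts n p' (\<lambda>i. D i - E i)"
    "excess n p D \<le> excess n p' (\<lambda>i. D i - E i) + deg n E"
proof -
  have "\<exists>p'. sorts n p' (\<lambda>i. D i - E i) \<and>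
      excess n p D \<le> excess n p' (\<lambda>i. D i - E i) + deg n E"
    using assms
  proof (induction "nat (deg n E)" arbitrary: p D E)
    case 0
    then have "(\<Sum>i<n. E i) = 0"
      using sum_nonneg[of "{..<n}" E] by (auto simp: deg_def effective_def)
    then have "\<forall>i<n. E i = 0"
      using 0 by (subst (asm) sum_nonneg_eq_0_iff) (auto simp: effective_def)
    then have "E i = 0" for i
      using 0 by (cases "i < n") (auto simp: divisors_def)
    then show ?case
      using 0 by (intro exI[of _ p]) (simp add: deg_def)
  next
    case (Suc m)
    then have "\<exists>v<n. E v \<noteq> 0"
      by (metis deg_def lessThan_iff nat_0_iff order_refl nat.simps(3) sum.neutral)
    then obtain v where v: "v < n" "E v \<ge> 1"
      using Suc.prems(3) by (force simp: effective_def)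
    let ?E = "E(v := E v - 1)"
    have "(\<Sum>i<n. ?E i) = (\<Sum>i<n. E i - (if i = v then 1 else 0))"
      by (rule sum.cong) auto
    then have dE: "deg n ?E = deg n E - 1"
      using v by (simp add: deg_def sum_subtractf sum.delta)
    obtain q where q: "sorts n q (D(v := D v - 1))"
      "excess n p D \<le> excess n q (D(v := D v - 1)) + 1"
      using sorts_remove_chip[OF Suc.prems(1) v(1)] .
    have eq: "(\<lambda>i. (D(v := D v - 1)) i - ?E i) = (\<lambda>i. D i - E i)"
      by auto
    have "\<exists>p'. sorts n p' (\<lambda>i. (D(v := D v - 1)) i - ?E i) \<and>
      excess n q (D(v := D v - 1)) \<le> excess n p' (\<lambda>i. (D(v := D v - 1)) i - ?E i) + deg n ?E"
    proof (rule Suc.hyps(1)[OF _ q(1)])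
      show "m = nat (deg n ?E)"
        using Suc.hyps(2) dE by linarith
      show "?E \<in> divisors n" "effective n ?E"
        using Suc.prems v by (auto simp: divisors_def effective_def)
    qed
    then show ?case
      unfolding eq using q(2) dE by force
  qed
  then show thesis
    using that by blast
qed

lemma sorts_identity:
  assumes "\<And>i j. i < j \<Longrightarrow> j < n \<Longrightarrow> D i \<le> D j" and "\<And>i j. i < n \<Longrightarrow> j < n \<Longrightarrow> D i \<le> D j + int n"
  shows "sorts n int D"
  unfolding sorts_def affine_perm_def
proof (intro conjI allI impI)
  show "inj_on (\<lambda>i. int i mod int n) {..<n}"
    by (auto simp: inj_on_def)
  fix i j k assume ij: "i < n" "j < n" "int i < int j + k * int n"
  have "0 < (k + 1) * int n"
    using ij by (simp add: algebra_simps)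
  then have "k \<ge> 0"
    using ij by (simp add: zero_less_mult_iff)
  then consider "k = 0" | "k \<ge> 1"
    by linarith
  then show "D i \<le> D j + k * int n"
  proof cases
    case 1
    then show ?thesis
      using ij assms(1) by simp
  next
    case 2
    then have "1 * int n \<le> k * int n"
      by (intro mult_right_mono) auto
    then show ?thesis
      using assms(2)[OF ij(1,2)] by simp
  qed
qed simp

text \<open>Every divisor arises from a constant one, sorted by the identity, by removing chips.\<close>

lemma ex_sorts:
  assumes D: "D \<in> divisors n"
  obtains p where "sorts n p D"
proof -
  define c where "c = (\<Sum>j<n. \<bar>D j\<bar>)"
  define E where "E i = (if i < n then c - D i else 0)" for i
  define C where "C i = (if i < n then c else 0)" for i
  have "sorts n int C"
    by (rule sorts_identity) (auto simp: C_def)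
  moreover have "E \<in> divisors n"
    by (simp add: E_def divisors_def)
  moreover have "effective n E"
  proof -
    have "\<bar>D i\<bar> \<le> c" if "i < n" for i
      unfolding c_def using that by (intro member_le_sum) auto
    then show ?thesis
      by (fastforce simp: effective_def E_def)
  qed
  ultimately obtain p where "sorts n p (\<lambda>i. C i - E i)"
    by (rule sorts_subtract_effective)
  moreover have "(\<lambda>i. C i - E i) = D"
    using D by (auto simp: C_def E_def divisors_def)
  ultimately show thesis
    using that by simp
qed

section \<open>The rank\<close>

text \<open>In terms of Baker--Norine theory, the divisors \<open>p - 1\<close> for affine permutations \<open>p\<close> are the
  maximal divisors without effective equivalent, and \<open>rk D + 1\<close> is the least number of chips whose
  removal brings \<open>D\<close> below one of them.  A sorting \<open>p\<close> attains this minimum.\<close>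

theorem rank_eq_excess:
  assumes n: "n \<ge> 1" and D: "D \<in> divisors n" and p: "sorts n p D"
  shows "rk n D = excess n p D - 1"
proof (cases "excess n p D \<ge> 1")
  case False
  then have "\<forall>i<n. D i \<le> p i - 1"
    using excess_pos_iff[of n p D] by force
  then have "\<not> equiv_effective n D"
    using p n by (intro not_equiv_effective_below_affine_perm[of n p]) (auto simp: sorts_def)
  then show ?thesis
    using False excess_nonneg[of n p D] by (simp add: rk_def)
next
  case True
  then have "equiv_effective n D"
    using equiv_effective_if_sorted[OF D p] by (auto simp: excess_pos_iff)
  moreover have "(GREATEST r. \<forall>E\<in>divisors n. effective n E \<and> deg n E = r \<longrightarrow>
             equiv_effective n (\<lambda>i. D i - E i)) = excess n p D - 1"
  proof (rule Greatest_equality)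
    show "\<forall>E\<in>divisors n. effective n E \<and> deg n E = excess n p D - 1 \<longrightarrow>
        equiv_effective n (\<lambda>i. D i - E i)"
    proof (intro ballI impI, elim conjE)
      fix E assume E: "E \<in> divisors n" "effective n E" "deg n E = excess n p D - 1"
      obtain q where q: "sorts n q (\<lambda>i. D i - E i)"
        "excess n p D \<le> excess n q (\<lambda>i. D i - E i) + deg n E"
        by (rule sorts_subtract_effective[OF p E(1,2)])
      have "excess n q (\<lambda>i. D i - E i) \<ge> 1"
        using q(2) E(3) by simp
      moreover have "(\<lambda>i. D i - E i) \<in> divisors n"
        using D E by (simp add: divisors_def)
      ultimately show "equiv_effective n (\<lambda>i. D i - E i)"
        using equiv_effective_if_sorted[OF _ q(1)] unfolding excess_pos_iff by blast
    qed
  next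
    fix r assume r: "\<forall>E\<in>divisors n. effective n E \<and> deg n E = r \<longrightarrow>
        equiv_effective n (\<lambda>i. D i - E i)"
    show "r \<le> excess n p D - 1"
    proof (rule ccontr)
      assume "\<not> r \<le> excess n p D - 1"
      then have extra: "r - excess n p D \<ge> 0"
        by simp
      \<comment> \<open>The chips of \<open>D\<close> above \<open>p - 1\<close>; the surplus at vertex \<open>0\<close> only adjusts the degree to \<open>r\<close>.\<close>
      define E where "E i = (if i < n then max 0 (D i - p i + 1) +
        (if i = 0 then r - excess n p D else 0) else 0)" for i
      have "deg n E = (\<Sum>i<n. max 0 (D i - p i + 1) + (if i = 0 then r - excess n p D else 0))"
        unfolding deg_def by (rule sum.cong) (auto simp: E_def)
      also have "\<dots> = r"
        using n by (simp add: sum.distrib sum.delta excess_def)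
      finally have "deg n E = r" .
      moreover have "E \<in> divisors n" "effective n E"
        using extra by (auto simp: E_def divisors_def effective_def)
      ultimately have "equiv_effective n (\<lambda>i. D i - E i)"
        using r by blast
      moreover have "\<not> equiv_effective n (\<lambda>i. D i - E i)"
      proof (rule not_equiv_effective_below_affine_perm[OF _ n])
        show "affine_perm n p"
          using p by (simp add: sorts_def)
        show "D i - E i \<le> p i - 1" if "i < n" for i
          using that extra by (auto simp: E_def)
      qed
      ultimately show False
        by contradiction
    qed
  qed
  ultimately show ?thesis
    by (simp add: rk_def)
qed

corollary rank_add_multiple_L:
  assumes "n \<ge> 1" "D \<in> divisors n" "sorts n p D"
  shows "rk n (\<lambda>i. D i + k * L n i) = (\<Sum>i<n. max 0 (D i - p i + k + 1)) - 1"
proof -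
  have "(\<lambda>i. D i + k * L n i) \<in> divisors n"
    using assms by (simp add: divisors_def L_def)
  then have "rk n (\<lambda>i. D i + k * L n i) = excess n p (\<lambda>i. D i + k * L n i) - 1"
    using assms by (intro rank_eq_excess sorts_add_multiple_L)
  also have "excess n p (\<lambda>i. D i + k * L n i) = (\<Sum>i<n. max 0 (D i - p i + k + 1))"
    unfolding excess_def by (rule sum.cong) (auto simp: L_def)
  finally show ?thesis .
qed

section \<open>Splitting types\<close>

text \<open>Let \<open>e\<close> be the value \<open>D i - p i\<close> at a position.  From one position to the next the entry
  does not decrease, so \<open>e\<close> drops by at most one.  If \<open>t\<close> were skipped, \<open>e\<close> would stay above \<open>t\<close>
  from \<open>p a\<close> onwards for ever, in particular at some later lift of \<open>p b\<close>.\<close>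

lemma sorts_values_convex:
  assumes n: "n \<ge> 1" and p: "sorts n p D" and a: "a < n" "t < D a - p a"
    and b: "b < n" "D b - p b < t"
  obtains c where "c < n" "D c - p c = t"
proof -
  have aff: "affine_perm n p"
    using p by (simp add: sorts_def)
  have "\<exists>c<n. D c - p c = t"
  proof (rule ccontr)
    assume none: "\<not> (\<exists>c<n. D c - p c = t)"
    have above: "\<forall>i<n. \<forall>k. p i + k * int n = p a + int m \<longrightarrow> t < D i - p i" for m
    proof (induction m)
      case 0
      show ?case
      proof (intro allI impI)
        fix i k assume i: "i < n" "p i + k * int n = p a + int 0"
        then have "p i mod int n = p a mod int n"
          by (metis add_0_right mod_mult_self1 of_nat_0)
        then have "i = a"
          using aff i a by (auto simp: affine_perm_def inj_on_def)
        then show "t < D i - p i"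
          using a by simp
      qed
    next
      case (Suc m)
      show ?case
      proof (intro allI impI)
        fix i k assume i: "i < n" "p i + k * int n = p a + int (Suc m)"
        obtain j l where j: "j < n" "p a + int m = p j + l * int n"
          by (rule affine_perm_position[OF aff n])
        have "t < D j - p j"
          using Suc.IH j by metis
        moreover have "D j \<le> D i + (k - l) * int n"
          using i j by (intro sortsD[OF p]) (auto simp: algebra_simps)
        ultimately have "t \<le> D i - p i"
          using i j by (simp add: algebra_simps)
        then show "t < D i - p i"
          using none i by force
      qed
    qed
    \<comment> \<open>A period shift that brings \<open>p b\<close> past \<open>p a\<close>.\<close>
    define K where "K = \<bar>p a - p b\<bar>"
    have "K * 1 \<le> K * int n"
      using n by (intro mult_left_mono) (auto simp: K_def)
    moreover have "p a - p b \<le> K"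
      by (simp add: K_def)
    ultimately have "0 \<le> p b + K * int n - p a"
      by simp
    then have "p b + K * int n = p a + int (nat (p b + K * int n - p a))"
      by simp
    then have "t < D b - p b"
      using above b by blast
    then show False
      using b by simp
  qed
  then show thesis
    using that by blast
qed

text \<open>As a function of the integer \<open>s\<close>, \<open>max 0 s\<close> has second difference \<open>1\<close> at \<open>0\<close> and \<open>0\<close>
  elsewhere.\<close>

lemma sum_max_second_difference:
  fixes x :: "nat \<Rightarrow> int"
  shows "(\<Sum>i<n. max 0 (x i + (1 - t))) - 2 * (\<Sum>i<n. max 0 (x i + - t))
    + (\<Sum>i<n. max 0 (x i + (- 1 - t))) = int (card {i. i < n \<and> x i = t})"
proof -
  have "(\<Sum>i<n. max 0 (x i + (1 - t))) - 2 * (\<Sum>i<n. max 0 (x i + - t))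
    + (\<Sum>i<n. max 0 (x i + (- 1 - t)))
    = (\<Sum>i<n. max 0 (x i + (1 - t)) - 2 * max 0 (x i + - t) + max 0 (x i + (- 1 - t)))"
    by (simp add: sum.distrib sum_subtractf sum_distrib_left)
  also have "\<dots> = (\<Sum>i<n. if x i = t then 1 else 0)"
    by (rule sum.cong) (auto simp: max_def)
  also have "\<dots> = int (card {i. i < n \<and> x i = t})"
    by (simp add: sum.If_cases Int_def conj_commute)
  finally show ?thesis .
qed

lemma sum_max_determines_values:
  fixes x y :: "nat \<Rightarrow> int"
  assumes "\<And>m. (\<Sum>i<n. max 0 (x i + m)) = (\<Sum>i<n. max 0 (y i + m))"
  shows "x ` {..<n} = y ` {..<n}"
proof -
  have card: "card {i. i < n \<and> x i = t} = card {i. i < n \<and> y i = t}" for t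
    using sum_max_second_difference[where x = x and n = n and t = t]
      sum_max_second_difference[where x = y and n = n and t = t]
    unfolding assms by linarith
  have "t \<in> x ` {..<n} \<longleftrightarrow> t \<in> y ` {..<n}" for t
  proof -
    have "t \<in> z ` {..<n} \<longleftrightarrow> card {i. i < n \<and> z i = t} \<noteq> 0" for z :: "nat \<Rightarrow> int"
      by (auto simp: card_eq_0_iff)
    then show ?thesis
      using card[of t] by metis
  qed
  then show ?thesis
    by blast
qed

theorem corollary1p4:
  fixes n :: nat and es :: "int list"
  assumes "n \<ge> 1" and "length es = n"
  shows "(\<exists>D\<in>divisors n. has_splitting_type n D es) \<longleftrightarrow>
    (\<forall>i. i + 1 < n \<longrightarrow> rev (sort es) ! i \<le> rev (sort es) ! (i + 1) + 1)"
proof -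
  define xs where "xs = rev (sort es)"
  have len: "length xs = n" and set: "set xs = set es" and mset: "mset xs = mset es"
    using assms by (auto simp: xs_def)
  have decreasing: "xs ! j \<le> xs ! i" if "i \<le> j" "j < n" for i j
  proof -
    have "sort es ! (n - Suc j) \<le> sort es ! (n - Suc i)"
      using that assms by (intro sorted_nth_mono) auto
    then show ?thesis
      using that assms by (simp add: xs_def rev_nth)
  qed
  have "(\<exists>D\<in>divisors n. has_splitting_type n D es) \<longleftrightarrow>
    (\<forall>i. i + 1 < n \<longrightarrow> xs ! i \<le> xs ! (i + 1) + 1)"
  proof (intro iffI allI impI)
    fix i assume i: "i + 1 < n"
    assume "\<exists>D\<in>divisors n. has_splitting_type n D es"
    then obtain D where D: "D \<in> divisors n" "has_splitting_type n D es"
      by blast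
    obtain p where p: "sorts n p D"
      using ex_sorts[OF D(1)] .
    have same_rank: "(\<Sum>i<n. max 0 (D i - p i + k + 1)) = (\<Sum>i<n. max 0 (es ! i + k + 1))"
      for k
      using rank_add_multiple_L[OF assms(1) D(1) p, of k] D(2)
      unfolding has_splitting_type_def by force
    have "(\<Sum>i<n. max 0 (D i - p i + m)) = (\<Sum>i<n. max 0 (es ! i + m))" for m
      using same_rank[of "m - 1"] by (simp add: algebra_simps)
    then have "(\<lambda>i. D i - p i) ` {..<n} = (\<lambda>i. es ! i) ` {..<n}"
      by (rule sum_max_determines_values)
    then have xs_values: "(\<lambda>i. D i - p i) ` {..<n} = set xs"
      using assms by (auto simp: set in_set_conv_nth)
    show "xs ! i \<le> xs ! (i + 1) + 1"
    proof (rule ccontr)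
      define t where "t = xs ! (i + 1) + 1"
      assume "\<not> xs ! i \<le> xs ! (i + 1) + 1"
      then have t: "t < xs ! i" "xs ! (i + 1) < t"
        by (auto simp: t_def)
      have "xs ! i \<in> set xs" "xs ! (i + 1) \<in> set xs"
        using i len by auto
      then obtain a b where ab: "a < n" "D a - p a = xs ! i" "b < n" "D b - p b = xs ! (i + 1)"
        unfolding xs_values[symmetric] by auto
      obtain c where "c < n" "D c - p c = t"
        by (rule sorts_values_convex[OF assms(1) p, of a t b]) (use ab t in auto)
      then have "t \<in> set xs"
        using xs_values by auto
      then obtain l where l: "l < n" "xs ! l = t"
        using len by (auto simp: in_set_conv_nth)
      show False
      proof (cases "l \<le> i")
        case True
        then show False
          using decreasing[of l i] i l t by simp
      next
        case False
        then show False
          using decreasing[of "i + 1" l] l t by simp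
      qed
    qed
  next
    assume gaps: "\<forall>i. i + 1 < n \<longrightarrow> xs ! i \<le> xs ! (i + 1) + 1"
    define D where "D i = (if i < n then xs ! i + int i else 0)" for i
    have D: "D \<in> divisors n"
      by (simp add: D_def divisors_def)
    \<comment> \<open>The gap condition is exactly monotonicity of \<open>D\<close>; decrease of the \<open>xs\<close> bounds its total rise.\<close>
    have mono: "D i \<le> D j" if "i \<le> j" "j < n" for i j
      using that
    proof (induction j rule: dec_induct)
      case (step j)
      then have "D j \<le> D (Suc j)"
        using gaps by (auto simp: D_def)
      then show ?case
        using step by simp
    qed simp
    have p: "sorts n int D"
    proof (rule sorts_identity)
      show "D i \<le> D j + int n" if "i < n" "j < n" for i j
      proof -
        have "D i \<le> D (n - 1)" "D 0 \<le> D j"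
          using that mono by auto
        moreover have "D (n - 1) \<le> D 0 + int n"
          using decreasing[of 0 "n - 1"] assms by (simp add: D_def)
        ultimately show ?thesis
          by simp
      qed
    qed (simp add: mono)
    have "(\<Sum>i<n. max 0 (D i - int i + k + 1)) = (\<Sum>i<n. max 0 (es ! i + k + 1))" for k
    proof -
      have sum: "(\<Sum>i<n. g (ys ! i)) = sum_mset (image_mset g (mset ys))"
        if "length ys = n" for ys and g :: "int \<Rightarrow> int"
      proof -
        have "sum_mset (image_mset g (mset ys)) = sum_list (map g ys)"
          by (metis mset_map sum_mset_sum_list)
        then show ?thesis
          using that by (simp add: sum_list_sum_nth atLeast0LessThan)
      qed
      have "(\<Sum>i<n. max 0 (D i - int i + k + 1)) = (\<Sum>i<n. max 0 (xs ! i + k + 1))"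
        by (rule sum.cong) (auto simp: D_def)
      then show ?thesis
        using sum[OF len, of "\<lambda>x. max 0 (x + k + 1)"]
          sum[OF assms(2), of "\<lambda>x. max 0 (x + k + 1)"] mset
        by simp
    qed
    then have "has_splitting_type n D es"
      unfolding has_splitting_type_def using rank_add_multiple_L[OF assms(1) D p] by simp
    then show "\<exists>D\<in>divisors n. has_splitting_type n D es"
      using D by blast
  qed
  then show ?thesis
    unfolding xs_def .
qed

end
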